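(* Let $(C,e,\lambda,\oplus)$ be a Catalan structure, with secondary composition $\ominus$ and map $h\colon C\to C$ as defined in the context. Then $h(u\ominus v)=h(v)\oplus h(u)$ for all $u,v\in C$.
   Context: A Catalan structure is a quadruple $(C,e,\lambda,\oplus)$ where $C=\bigsqcup_{n\ge 0}C_n$ with $C_0=\{e\}$ ($|t|=n$ for $t\in C_n$), $\lambda\colon C_n\to C_{n+1}$, $\oplus\colon C_m\times C_n\to C_{m+n}$, $\oplus$ is associative with two-sided identity $e$, and every $t\in C$ can be written uniquely in exactly one of three forms: $t=e$; $t=\lambda(s)$ with $s\in C$ (indecomposable); $t=u\oplus v$ with $u$ indecomposable and $v\in C\setminus C_0$ (decomposable). Hence every nonempty $t$ is uniquely $\lambda(u)\oplus v$ ($v=e$ allowed). Put $\gamma(t)=t\oplus\lambda(e)$ and define $\ominus$ by $e\ominus v=v$, $\lambda(u)\ominus v=\lambda(u\ominus v)$, $(t\oplus u)\ominus v=t\oplus(u\ominus v)$ for $t,u\ne e$ (well defined; one may take $t$ indecomposable). The map $h$ is defined by $h(e)=e$, $h(\lambda(t))=\gamma(h(t))$, $h(u\oplus v)=h(v)\ominus h(u)$; equivalently $h(e)=e$ and $h(\lambda(u)\oplus v)=h(v)\ominus\gamma(h(u))$. *)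

theory Defs
  imports Main
begin

text \<open>
  The structure lives on a carrier inside the type \<open>'a\<close>, graded by \<open>C :: nat \<Rightarrow> 'a set\<close>; the
  operations are constrained on the carrier only.  The last six assumptions together say that each
  element of the carrier is uniquely of exactly one of the forms \<open>e\<close>, \<open>lam s\<close>, or \<open>u \<oplus> v\<close>
  with \<open>u\<close> in the image of \<open>lam\<close> and \<open>v\<close> outside \<open>C 0\<close>.
\<close>

locale catalan_structure =
  fixes C :: "nat \<Rightarrow> 'a set"
    and e :: 'a
    and lam :: "'a \<Rightarrow> 'a"
    and oplus :: "'a \<Rightarrow> 'a \<Rightarrow> 'a"  (infixr "\<oplus>" 65)
  assumes grading_disjoint: "m \<noteq> n \<Longrightarrow> C m \<inter> C n = {}"
    and C_0: "C 0 = {e}"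
    and lam_in: "t \<in> C n \<Longrightarrow> lam t \<in> C (Suc n)"
    and oplus_in: "t \<in> C m \<Longrightarrow> u \<in> C n \<Longrightarrow> t \<oplus> u \<in> C (m + n)"
    and oplus_assoc:
      "\<lbrakk>t \<in> (\<Union>n. C n); u \<in> (\<Union>n. C n); v \<in> (\<Union>n. C n)\<rbrakk> \<Longrightarrow> (t \<oplus> u) \<oplus> v = t \<oplus> (u \<oplus> v)"
    and oplus_e_left: "t \<in> (\<Union>n. C n) \<Longrightarrow> e \<oplus> t = t"
    and oplus_e_right: "t \<in> (\<Union>n. C n) \<Longrightarrow> t \<oplus> e = t"
    and decomposition_exists:
      "t \<in> (\<Union>n. C n) \<Longrightarrow>
        t = e \<or> (\<exists>s \<in> (\<Union>n. C n). t = lam s) \<or>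
        (\<exists>u \<in> lam ` (\<Union>n. C n). \<exists>v \<in> (\<Union>n. C n) - C 0. t = u \<oplus> v)"
    and lam_neq_e: "s \<in> (\<Union>n. C n) \<Longrightarrow> lam s \<noteq> e"
    and oplus_neq_e:
      "\<lbrakk>u \<in> lam ` (\<Union>n. C n); v \<in> (\<Union>n. C n) - C 0\<rbrakk> \<Longrightarrow> u \<oplus> v \<noteq> e"
    and lam_neq_oplus:
      "\<lbrakk>s \<in> (\<Union>n. C n); u \<in> lam ` (\<Union>n. C n); v \<in> (\<Union>n. C n) - C 0\<rbrakk> \<Longrightarrow> lam s \<noteq> u \<oplus> v"
    and lam_inj: "inj_on lam (\<Union>n. C n)"
    and oplus_inj:
      "inj_on (\<lambda>(u, v). u \<oplus> v) (lam ` (\<Union>n. C n) \<times> ((\<Union>n. C n) - C 0))"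
begin

definition carrier :: "'a set" where
  "carrier = (\<Union>n. C n)"

definition indecomposable :: "'a \<Rightarrow> bool" where
  "indecomposable t \<longleftrightarrow> t \<in> lam ` carrier"

definition gamma :: "'a \<Rightarrow> 'a" where
  "gamma t = t \<oplus> lam e"

text \<open>
  The operation \<open>\<ominus>\<close> and the map \<open>h\<close> are given by recursion along the unique decomposition:
  the graph is defined inductively and the value is read off with a definite description.
  That the graphs are functional and total on the carrier, and that the recursion equations
  hold for arbitrary (not only indecomposable) left summands, is proved in \<open>ominus_e\<close>,
  \<open>ominus_lam\<close>, \<open>ominus_oplus\<close> and \<open>h_e\<close>, \<open>h_lam\<close>, \<open>h_oplus\<close>, \<open>h_lam_oplus\<close>.
\<close>

inductive ominus_graph :: "'a \<Rightarrow> 'a \<Rightarrow> 'a \<Rightarrow> bool" where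
  "v \<in> carrier \<Longrightarrow> ominus_graph e v v"
| "\<lbrakk>u \<in> carrier; ominus_graph u v w\<rbrakk> \<Longrightarrow> ominus_graph (lam u) v (lam w)"
| "\<lbrakk>indecomposable t; u \<in> carrier; u \<noteq> e; ominus_graph u v w\<rbrakk>
    \<Longrightarrow> ominus_graph (t \<oplus> u) v (t \<oplus> w)"

definition ominus :: "'a \<Rightarrow> 'a \<Rightarrow> 'a"  (infixr "\<ominus>" 65) where
  "u \<ominus> v = (THE w. ominus_graph u v w)"

inductive h_graph :: "'a \<Rightarrow> 'a \<Rightarrow> bool" where
  "h_graph e e"
| "\<lbrakk>t \<in> carrier; h_graph t s\<rbrakk> \<Longrightarrow> h_graph (lam t) (gamma s)"
| "\<lbrakk>indecomposable u; v \<in> carrier; v \<noteq> e; h_graph u u'; h_graph v v'\<rbrakk>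
    \<Longrightarrow> h_graph (u \<oplus> v) (v' \<ominus> u')"

definition h :: "'a \<Rightarrow> 'a" where
  "h t = (THE s. h_graph t s)"

lemma e_carrier [simp]: "e \<in> carrier"
  using C_0 by (auto simp: carrier_def)

lemma lam_carrier [simp]: "t \<in> carrier \<Longrightarrow> lam t \<in> carrier"
  using lam_in unfolding carrier_def by blast

lemma oplus_carrier [simp]: "t \<in> carrier \<Longrightarrow> u \<in> carrier \<Longrightarrow> t \<oplus> u \<in> carrier"
  using oplus_in unfolding carrier_def by blast

lemma indecomposable_carrier: "indecomposable t \<Longrightarrow> t \<in> carrier"
  by (auto simp: indecomposable_def)

lemma indecomposable_neq_e: "indecomposable t \<Longrightarrow> t \<noteq> e"
  using lam_neq_e by (auto simp: indecomposable_def carrier_def)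

lemma indecomposable_lam [simp]: "t \<in> carrier \<Longrightarrow> indecomposable (lam t)"
  by (auto simp: indecomposable_def)

lemma indecomposable_neq_oplus:
  "indecomposable t \<Longrightarrow> indecomposable u \<Longrightarrow> v \<in> carrier \<Longrightarrow> v \<noteq> e \<Longrightarrow> t \<noteq> u \<oplus> v"
  using lam_neq_oplus[unfolded C_0, folded carrier_def]
  by (auto simp: indecomposable_def)

lemma indecomposable_oplus_neq_e:
  "indecomposable u \<Longrightarrow> v \<in> carrier \<Longrightarrow> v \<noteq> e \<Longrightarrow> u \<oplus> v \<noteq> e"
  using oplus_neq_e[unfolded C_0, folded carrier_def] by (simp add: indecomposable_def)

lemma lam_eqD: "lam s = lam t \<Longrightarrow> s \<in> carrier \<Longrightarrow> t \<in> carrier \<Longrightarrow> s = t"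
  using lam_inj unfolding carrier_def by (meson inj_onD)

lemma oplus_eqD:
  assumes "u \<oplus> v = u' \<oplus> v'" "indecomposable u" "indecomposable u'"
    "v \<in> carrier" "v \<noteq> e" "v' \<in> carrier" "v' \<noteq> e"
  shows "u = u' \<and> v = v'"
proof -
  have "(u, v) \<in> lam ` (\<Union>n. C n) \<times> ((\<Union>n. C n) - C 0)"
    "(u', v') \<in> lam ` (\<Union>n. C n) \<times> ((\<Union>n. C n) - C 0)"
    using assms C_0 unfolding indecomposable_def carrier_def by blast+
  from inj_onD[OF oplus_inj _ this] show ?thesis using assms(1) by simp
qed

lemma oplus_assoc': "t \<in> carrier \<Longrightarrow> u \<in> carrier \<Longrightarrow> v \<in> carrier \<Longrightarrow> (t \<oplus> u) \<oplus> v = t \<oplus> (u \<oplus> v)"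
  using oplus_assoc by (simp add: carrier_def)

lemma oplus_e [simp]:
  "t \<in> carrier \<Longrightarrow> e \<oplus> t = t"
  "t \<in> carrier \<Longrightarrow> t \<oplus> e = t"
  using oplus_e_left oplus_e_right by (simp_all add: carrier_def)

lemma catalan_induct [consumes 1, case_names e lam oplus]:
  assumes "t \<in> carrier"
    and Pe: "P e"
    and Pl: "\<And>s. s \<in> carrier \<Longrightarrow> P s \<Longrightarrow> P (lam s)"
    and Po: "\<And>u v. \<lbrakk>indecomposable u; v \<in> carrier; v \<noteq> e; P u; P v\<rbrakk> \<Longrightarrow> P (u \<oplus> v)"
  shows "P t"
proof -
  have "t \<in> C n \<Longrightarrow> P t" for n
  proof (induction n arbitrary: t rule: less_induct)
    case (less n)
    have t: "t \<in> carrier" using less.prems by (auto simp: carrier_def)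
    from decomposition_exists[unfolded C_0, folded carrier_def, OF t] consider
      "t = e" | s where "s \<in> carrier" "t = lam s"
      | u v where "indecomposable u" "v \<in> carrier" "v \<noteq> e" "t = u \<oplus> v"
      by (auto simp: indecomposable_def)
    then show ?case
    proof cases
      case 1
      then show ?thesis using Pe by simp
    next
      case 2
      then obtain k where k: "s \<in> C k" by (auto simp: carrier_def)
      then have "Suc k = n"
        using lam_in[OF k] 2 less.prems grading_disjoint by blast
      then have "P s" using less.IH[OF _ k] by simp
      then show ?thesis using 2 Pl by simp
    next
      case 3
      then obtain s where s: "s \<in> carrier" "u = lam s" by (auto simp: indecomposable_def)
      then obtain k where k: "s \<in> C k" by (auto simp: carrier_def)
      have uk: "u \<in> C (Suc k)" using lam_in[OF k] s by simp
      from 3 obtain m where m: "v \<in> C m" by (auto simp: carrier_def)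
      have "m \<noteq> 0" using m 3 C_0 by (cases "m = 0") auto
      moreover have "Suc k + m = n"
        using oplus_in[OF uk m] 3 less.prems grading_disjoint by blast
      ultimately have "P u" "P v" using less.IH[OF _ uk] less.IH[OF _ m] by simp_all
      then show ?thesis using 3 Po by simp
    qed
  qed
  then show ?thesis using assms(1) by (auto simp: carrier_def)
qed

lemma oplus_neq_e':
  assumes "t \<in> carrier" "u \<in> carrier" "t \<noteq> e"
  shows "t \<oplus> u \<noteq> e"
  using assms
proof (induction t rule: catalan_induct)
  case e
  then show ?case by simp
next
  case (lam s)
  then show ?case
    by (cases "u = e") (auto simp: indecomposable_oplus_neq_e)
next
  case (oplus a b)
  then have "(a \<oplus> b) \<oplus> u = a \<oplus> (b \<oplus> u)" "b \<oplus> u \<in> carrier" "b \<oplus> u \<noteq> e"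
    by (simp_all add: oplus_assoc' indecomposable_carrier)
  then show ?case using indecomposable_oplus_neq_e oplus by simp
qed

lemma ominus_graph_carrier: "ominus_graph u v w \<Longrightarrow> u \<in> carrier \<and> v \<in> carrier \<and> w \<in> carrier"
  by (induction rule: ominus_graph.induct) (auto simp: indecomposable_carrier)

lemma ominus_graph_ex1:
  assumes "u \<in> carrier" "v \<in> carrier"
  shows "\<exists>!w. ominus_graph u v w"
  using assms
proof (induction u rule: catalan_induct)
  case e
  show ?case
  proof (rule ex1I)
    show "ominus_graph e v v" using e by (rule ominus_graph.intros)
    fix w assume "ominus_graph e v w"
    then show "w = v"
      by cases (auto dest: indecomposable_neq_e[OF indecomposable_lam]
          indecomposable_oplus_neq_e simp: eq_commute[of e])
  qed
next
  case (lam s)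
  then obtain w where w: "ominus_graph s v w" "\<And>w'. ominus_graph s v w' \<Longrightarrow> w' = w" by blast
  show ?case
  proof (rule ex1I)
    show "ominus_graph (lam s) v (lam w)" by (intro ominus_graph.intros lam.hyps w(1))
    fix x assume "ominus_graph (lam s) v x"
    then show "x = lam w"
    proof cases
      case 1
      then show ?thesis using lam indecomposable_neq_e indecomposable_lam by metis
    next
      case (2 s' w')
      then show ?thesis using lam w lam_eqD by metis
    next
      case (3 t u w')
      then show ?thesis using lam indecomposable_neq_oplus indecomposable_lam by metis
    qed
  qed
next
  case (oplus a b)
  then obtain w where w: "ominus_graph b v w" "\<And>w'. ominus_graph b v w' \<Longrightarrow> w' = w" by blast
  show ?case
  proof (rule ex1I)
    show "ominus_graph (a \<oplus> b) v (a \<oplus> w)" by (intro ominus_graph.intros oplus.hyps w(1))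
    fix x assume "ominus_graph (a \<oplus> b) v x"
    then show "x = a \<oplus> w"
    proof cases
      case 1
      then show ?thesis using oplus indecomposable_oplus_neq_e by metis
    next
      case (2 s' w')
      then show ?thesis using oplus indecomposable_neq_oplus indecomposable_lam by metis
    next
      case (3 t u w')
      then show ?thesis using oplus w oplus_eqD by metis
    qed
  qed
qed

lemma ominus_graph_ominus: "u \<in> carrier \<Longrightarrow> v \<in> carrier \<Longrightarrow> ominus_graph u v (u \<ominus> v)"
  unfolding ominus_def by (rule theI'[OF ominus_graph_ex1])

lemma ominus_eqI:
  assumes "ominus_graph u v w"
  shows "u \<ominus> v = w"
  using assms ominus_graph_ex1 ominus_graph_ominus ominus_graph_carrier by blast

lemma ominus_carrier [simp]: "u \<in> carrier \<Longrightarrow> v \<in> carrier \<Longrightarrow> u \<ominus> v \<in> carrier"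
  using ominus_graph_ominus ominus_graph_carrier by blast

lemma ominus_e: "v \<in> carrier \<Longrightarrow> e \<ominus> v = v"
  by (intro ominus_eqI ominus_graph.intros)

lemma ominus_lam: "u \<in> carrier \<Longrightarrow> v \<in> carrier \<Longrightarrow> lam u \<ominus> v = lam (u \<ominus> v)"
  by (intro ominus_eqI ominus_graph.intros ominus_graph_ominus)

lemma ominus_indecomposable_oplus:
  "\<lbrakk>indecomposable t; u \<in> carrier; u \<noteq> e; v \<in> carrier\<rbrakk> \<Longrightarrow> (t \<oplus> u) \<ominus> v = t \<oplus> (u \<ominus> v)"
  by (intro ominus_eqI ominus_graph.intros ominus_graph_ominus)

lemma ominus_oplus:
  assumes "t \<in> carrier" "u \<in> carrier" "v \<in> carrier" "t \<noteq> e" "u \<noteq> e"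
  shows "(t \<oplus> u) \<ominus> v = t \<oplus> (u \<ominus> v)"
  using assms
proof (induction t rule: catalan_induct)
  case e
  then show ?case by simp
next
  case (lam s)
  then show ?case by (simp add: ominus_indecomposable_oplus)
next
  case (oplus a b)
  then have "(a \<oplus> b) \<oplus> u = a \<oplus> (b \<oplus> u)" "b \<oplus> u \<noteq> e"
    by (simp_all add: oplus_assoc' indecomposable_carrier oplus_neq_e')
  then show ?case
    using oplus by (simp add: ominus_indecomposable_oplus oplus_assoc' indecomposable_carrier)
qed

lemma ominus_e_right: "u \<in> carrier \<Longrightarrow> u \<ominus> e = u"
  by (induction u rule: catalan_induct)
    (simp_all add: ominus_e ominus_lam ominus_indecomposable_oplus)

lemma ominus_neq_e:
  "u \<in> carrier \<Longrightarrow> v \<in> carrier \<Longrightarrow> u \<noteq> e \<Longrightarrow> u \<ominus> v \<noteq> e"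
  by (induction u rule: catalan_induct)
    (auto simp: ominus_lam ominus_indecomposable_oplus indecomposable_neq_e
      indecomposable_oplus_neq_e)

lemma ominus_assoc:
  assumes "t \<in> carrier" "u \<in> carrier" "v \<in> carrier"
  shows "(t \<ominus> u) \<ominus> v = t \<ominus> (u \<ominus> v)"
  using assms
  by (induction t rule: catalan_induct)
    (simp_all add: ominus_e ominus_lam ominus_indecomposable_oplus ominus_neq_e)

lemma gamma_carrier [simp]: "t \<in> carrier \<Longrightarrow> gamma t \<in> carrier"
  by (simp add: gamma_def)

lemma h_graph_carrier: "h_graph t s \<Longrightarrow> t \<in> carrier \<and> s \<in> carrier"
  by (induction rule: h_graph.induct) auto

lemma h_graph_ex1:
  assumes "t \<in> carrier"
  shows "\<exists>!s. h_graph t s"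
  using assms
proof (induction t rule: catalan_induct)
  case e
  show ?case
  proof (rule ex1I)
    show "h_graph e e" by (rule h_graph.intros)
    fix w assume "h_graph e w"
    then show "w = e"
      by cases (auto dest: indecomposable_neq_e[OF indecomposable_lam]
          indecomposable_oplus_neq_e simp: eq_commute[of e])
  qed
next
  case (lam s)
  then obtain w where w: "h_graph s w" "\<And>w'. h_graph s w' \<Longrightarrow> w' = w" by blast
  show ?case
  proof (rule ex1I)
    show "h_graph (lam s) (gamma w)" by (intro h_graph.intros lam.hyps w(1))
    fix x assume "h_graph (lam s) x"
    then show "x = gamma w"
    proof cases
      case 1
      then show ?thesis using lam indecomposable_neq_e indecomposable_lam by metis
    next
      case (2 s' w')
      then show ?thesis using lam w lam_eqD by metis
    next
      case (3 u v u' v')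
      then show ?thesis using lam indecomposable_neq_oplus indecomposable_lam by metis
    qed
  qed
next
  case (oplus a b)
  then obtain p q where p: "h_graph a p" "\<And>w'. h_graph a w' \<Longrightarrow> w' = p"
    and q: "h_graph b q" "\<And>w'. h_graph b w' \<Longrightarrow> w' = q" by blast
  show ?case
  proof (rule ex1I)
    show "h_graph (a \<oplus> b) (q \<ominus> p)" by (intro h_graph.intros oplus.hyps p(1) q(1))
    fix x assume "h_graph (a \<oplus> b) x"
    then show "x = q \<ominus> p"
    proof cases
      case 1
      then show ?thesis using oplus indecomposable_oplus_neq_e by metis
    next
      case (2 s' w')
      then show ?thesis using oplus indecomposable_neq_oplus indecomposable_lam by metis
    next
      case (3 u v u' v')
      then have "u = a" "v = b" using oplus oplus_eqD by metis+
      then show ?thesis using 3 p q by blast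
    qed
  qed
qed

lemma h_graph_h: "t \<in> carrier \<Longrightarrow> h_graph t (h t)"
  unfolding h_def by (rule theI'[OF h_graph_ex1])

lemma h_eqI:
  assumes "h_graph t s"
  shows "h t = s"
  using assms h_graph_ex1 h_graph_h h_graph_carrier by blast

lemma h_carrier [simp]: "t \<in> carrier \<Longrightarrow> h t \<in> carrier"
  using h_graph_h h_graph_carrier by blast

lemma h_e: "h e = e"
  by (intro h_eqI h_graph.intros)

lemma h_lam: "t \<in> carrier \<Longrightarrow> h (lam t) = gamma (h t)"
  by (intro h_eqI h_graph.intros h_graph_h)

lemma h_indecomposable_oplus:
  "\<lbrakk>indecomposable u; v \<in> carrier; v \<noteq> e\<rbrakk> \<Longrightarrow> h (u \<oplus> v) = h v \<ominus> h u"
  by (intro h_eqI h_graph.intros h_graph_h) (auto intro: indecomposable_carrier)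

lemma h_oplus:
  assumes "u \<in> carrier" "v \<in> carrier"
  shows "h (u \<oplus> v) = h v \<ominus> h u"
proof (cases "v = e")
  case True
  then show ?thesis using assms by (simp add: h_e ominus_e)
next
  case False
  show ?thesis using assms
  proof (induction u rule: catalan_induct)
    case e
    then show ?case by (simp add: h_e ominus_e_right)
  next
    case (lam s)
    then show ?case using False by (simp add: h_indecomposable_oplus)
  next
    case (oplus a b)
    then have "b \<oplus> v \<noteq> e" by (simp add: oplus_neq_e')
    then show ?case
      using oplus
      by (simp add: oplus_assoc' indecomposable_carrier h_indecomposable_oplus ominus_assoc)
  qed
qed

lemma h_lam_oplus:
  "u \<in> carrier \<Longrightarrow> v \<in> carrier \<Longrightarrow> h (lam u \<oplus> v) = h v \<ominus> gamma (h u)"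
  by (simp add: h_oplus h_lam)

end

end

theory Submission
  imports Defs
begin

text \<open>Induction on \<open>u\<close> along its unique decomposition. For
  \<open>u = lam s\<close>, \<open>gamma\<close> only appends \<open>lam e\<close> on the right, so
  associativity of \<oplus> suffices. For \<open>u = a \<oplus> b\<close>, \<open>h\<close> turns
  \<oplus> into a reversed \<ominus>, and the claim becomes the mixed associativity law
  \<open>oplus_ominus_assoc\<close> for \<open>h v\<close>, \<open>h b\<close>, \<open>h a\<close>;
  its side condition on the middle term is \<open>h_neq_e\<close>.\<close>

context catalan_structure
begin

lemma gamma_neq_e: "t \<in> carrier \<Longrightarrow> gamma t \<noteq> e"
  by (cases "t = e") (simp_all add: gamma_def indecomposable_neq_e oplus_neq_e')

lemma h_neq_e: "t \<in> carrier \<Longrightarrow> t \<noteq> e \<Longrightarrow> h t \<noteq> e"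
  by (induction t rule: catalan_induct)
    (simp_all add: h_lam gamma_neq_e h_indecomposable_oplus indecomposable_carrier ominus_neq_e)

text \<open>The case \<open>t = e\<close> is included because \<open>h v\<close> may be empty. The
  middle term must not be: for \<open>u = e\<close> the law would identify
  \<open>t \<ominus> v\<close> with \<open>t \<oplus> v\<close>.\<close>

lemma oplus_ominus_assoc:
  assumes "t \<in> carrier" "u \<in> carrier" "v \<in> carrier" "u \<noteq> e"
  shows "(t \<oplus> u) \<ominus> v = t \<oplus> (u \<ominus> v)"
  using assms by (cases "t = e") (simp_all add: ominus_oplus)

lemma h_ominus:
  assumes "u \<in> carrier" "v \<in> carrier"
  shows "h (u \<ominus> v) = h v \<oplus> h u"
  using assms
proof (induction u rule: catalan_induct)
  case e
  then show ?case by (simp add: ominus_e h_e)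
next
  case (lam s)
  then show ?case by (simp add: ominus_lam h_lam gamma_def oplus_assoc')
next
  case (oplus a b)
  \<comment> \<open>\<ominus> acts only on the last summand \<open>b\<close>, where the induction
    hypothesis applies.\<close>
  then have "h ((a \<oplus> b) \<ominus> v) = (h v \<oplus> h b) \<ominus> h a"
    by (simp add: ominus_indecomposable_oplus h_oplus indecomposable_carrier)
  also have "\<dots> = h v \<oplus> (h b \<ominus> h a)"
    using oplus by (simp add: oplus_ominus_assoc h_neq_e indecomposable_carrier)
  finally show ?case
    using oplus by (simp add: h_indecomposable_oplus)
qed

end

theorem corollary2p10:
  fixes C :: "nat \<Rightarrow> 'a set"
    and e :: 'a
    and lam :: "'a \<Rightarrow> 'a"
    and oplus :: "'a \<Rightarrow> 'a \<Rightarrow> 'a"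
    and u v :: 'a
  assumes "catalan_structure C e lam oplus"
    and "u \<in> catalan_structure.carrier C"
    and "v \<in> catalan_structure.carrier C"
  shows "catalan_structure.h C e lam oplus (catalan_structure.ominus C e lam oplus u v) =
    oplus (catalan_structure.h C e lam oplus v) (catalan_structure.h C e lam oplus u)"
  using assms by (rule catalan_structure.h_ominus)

end
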